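(* Let $n\ge 3$, and let $(X,d)$ and $(X',d')$ be two $\Delta$-generic metric spaces with $n$ elements, labeled $P_1,\dots,P_n$ and $P'_1,\dots,P'_n$ respectively, with Gromov product structures $$S=\{\Delta_{1i_1j_1},\dots,\Delta_{ni_nj_n}\},\qquad S'=\{\Delta_{1a_1b_1},\dots,\Delta_{na_nb_n}\}.$$ Let $G_S$ and $G_{S'}$ be the $n\times n$ matrices defined by $G_S(k,l)=1$ if $l=i_k$ or $l=j_k$, and $G_S(k,l)=0$ otherwise; and $G_{S'}(k,l)=1$ if $l=a_k$ or $l=b_k$, and $G_{S'}(k,l)=0$ otherwise. Assume that there is a permutation $\pi$ of $\{1,\dots,n\}$ that maps $S$ to $S'$, i.e. for every $k\in\{1,\dots,n\}$, $$\{\pi(i_k),\pi(j_k)\}=\{a_{\pi(k)},b_{\pi(k)}\},$$ and let $P$ be the corresponding $n\times n$ permutation matrix, with $P_{k,\pi(k)}=1$ for all $k$ and all other entries $0$. Then $$G_S\,P=P\,G_{S'}.$$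
   Context: Let $(X,d)$ be a finite metric space with $n\ge 3$ elements $P_1,\dots,P_n$, and write $d_{ij}$ for the distance between $P_i$ and $P_j$. For distinct indices $i,j,k$, the Gromov product of the triangle $(P_i,P_j,P_k)$ at the vertex $P_i$ is $$\Delta_{ijk}=\tfrac12\,(d_{ij}+d_{ik}-d_{jk}),$$ which is symmetric in $j$ and $k$ (so $\Delta_{ijk}$ and $\Delta_{ikj}$ denote the same Gromov product). The space is called $\Delta$-generic if, for each $i=1,\dots,n$, the set of all Gromov products at $P_i$ (over unordered pairs $\{j,k\}$ of distinct indices different from $i$) has a unique smallest element. The Gromov product structure of a $\Delta$-generic labeled space is the collection of minimal Gromov products, one at each point, written $S=\{\Delta_{1i_1j_1},\dots,\Delta_{ni_nj_n}\}$. Here the notation records the index data: for each $k$, $\{i_k,j_k\}$ is the unique unordered pair of distinct indices different from $k$ for which $\Delta_{ki_kj_k}$ is the smallest Gromov product at $P_k$. A permutation of the indices maps $S$ to $S'$ if it carries the index data of the minimal Gromov products in $S$ to those in $S'$; numerical values of the Gromov products are not compared. *)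

theory Defs
  imports "HOL-Analysis.Analysis"
begin

text \<open>
  A labeled metric space with \<open>n\<close> points is given by a metric \<open>d\<close> on a carrier and an
  enumeration \<open>p :: 'n \<Rightarrow> 'a\<close> of the carrier, where the finite type \<open>'n\<close> with
  \<open>n = CARD('n)\<close> plays the role of the index set \<open>{1, \<dots>, n}\<close>.
\<close>

definition gromov_product :: "('a \<Rightarrow> 'a \<Rightarrow> real) \<Rightarrow> ('n \<Rightarrow> 'a) \<Rightarrow> 'n \<Rightarrow> 'n \<Rightarrow> 'n \<Rightarrow> real" where
  "gromov_product d p i j k = (d (p i) (p j) + d (p i) (p k) - d (p j) (p k)) / 2"

definition minimal_gromov_pairs :: "('a \<Rightarrow> 'a \<Rightarrow> real) \<Rightarrow> ('n \<Rightarrow> 'a) \<Rightarrow> 'n \<Rightarrow> 'n set set" where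
  "minimal_gromov_pairs d p k =
     {{i, j} | i j. distinct [k, i, j] \<and>
        (\<forall>i' j'. distinct [k, i', j'] \<longrightarrow> gromov_product d p k i j \<le> gromov_product d p k i' j')}"

text \<open>
  Uniqueness of the smallest Gromov product refers to the index pair attaining it, not merely
  to its numerical value (a minimal value is always unique).
\<close>

definition Delta_generic :: "('a \<Rightarrow> 'a \<Rightarrow> real) \<Rightarrow> ('n \<Rightarrow> 'a) \<Rightarrow> bool" where
  "Delta_generic d p \<longleftrightarrow> (\<forall>k. \<exists>!e. e \<in> minimal_gromov_pairs d p k)"

text \<open>
  The Gromov product structure, as the index data \<open>k \<mapsto> {i\<^sub>k, j\<^sub>k}\<close>;
  meaningful only for \<open>\<Delta>\<close>-generic spaces.
\<close>

definition gromov_structure :: "('a \<Rightarrow> 'a \<Rightarrow> real) \<Rightarrow> ('n \<Rightarrow> 'a) \<Rightarrow> 'n \<Rightarrow> 'n set" where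
  "gromov_structure d p k = (THE e. e \<in> minimal_gromov_pairs d p k)"

definition structure_matrix :: "('n \<Rightarrow> 'n) \<Rightarrow> ('n \<Rightarrow> 'n) \<Rightarrow> real ^ 'n ^ 'n" where
  "structure_matrix i j = (\<chi> k l. if l = i k \<or> l = j k then 1 else 0)"

definition permutation_matrix :: "('n \<Rightarrow> 'n) \<Rightarrow> real ^ 'n ^ 'n" where
  "permutation_matrix \<pi> = (\<chi> k l. if l = \<pi> k then 1 else 0)"

end

theory Submission
  imports Defs
begin

text \<open>
  Multiplying by the permutation matrix on the left relabels rows, multiplying on the right
  relabels columns. Hence at position \<open>(k, \<pi> m)\<close> the two products are the
  entry \<open>(k, m)\<close> of the first structure matrix and the entry \<open>(\<pi> k, \<pi> m)\<close> of the
  second one. The first is \<open>1\<close> exactly if \<open>m\<close> belongs to the minimal pair at \<open>k\<close>, the second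
  exactly if \<open>\<pi> m\<close> belongs to the minimal pair at \<open>\<pi> k\<close>; these conditions agree because
  the injective map \<open>\<pi>\<close> carries the one pair onto the other. Surjectivity of \<open>\<pi>\<close>
  makes the positions \<open>(k, \<pi> m)\<close> exhaust the matrix.
\<close>

lemma permutation_matrix_mult_entry:
  fixes \<pi> :: "'n::finite \<Rightarrow> 'n" and A :: "real ^ 'n ^ 'n"
  shows "(permutation_matrix \<pi> ** A) $ k $ l = A $ \<pi> k $ l"
  by (simp add: matrix_matrix_mult_def permutation_matrix_def if_distrib[of "\<lambda>x. x * _"]
      cong: if_cong)

lemma mult_permutation_matrix_entry:
  fixes \<pi> :: "'n::finite \<Rightarrow> 'n" and A :: "real ^ 'n ^ 'n"
  assumes "inj \<pi>"
  shows "(A ** permutation_matrix \<pi>) $ k $ \<pi> m = A $ k $ m"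
  by (simp add: matrix_matrix_mult_def permutation_matrix_def inj_eq[OF assms]
      if_distrib[of "\<lambda>x. _ * x"] cong: if_cong)

lemma structure_matrix_entry:
  "structure_matrix i j $ k $ l = (if l \<in> {i k, j k} then 1 else 0)"
  by (simp add: structure_matrix_def)

theorem proposition2p1:
  fixes X :: "'a set" and d :: "'a \<Rightarrow> 'a \<Rightarrow> real" and p :: "'n::finite \<Rightarrow> 'a"
    and X' :: "'b set" and d' :: "'b \<Rightarrow> 'b \<Rightarrow> real" and p' :: "'n \<Rightarrow> 'b"
    and i j a b \<pi> :: "'n \<Rightarrow> 'n"
  assumes "CARD('n) \<ge> 3"
    and "Metric_space X d" and "bij_betw p UNIV X" and "Delta_generic d p"
    and "Metric_space X' d'" and "bij_betw p' UNIV X'" and "Delta_generic d' p'"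
    and "\<And>k. gromov_structure d p k = {i k, j k}"
    and "\<And>k. gromov_structure d' p' k = {a k, b k}"
    and "\<pi> permutes UNIV"
    and "\<And>k. {\<pi> (i k), \<pi> (j k)} = {a (\<pi> k), b (\<pi> k)}"
  shows "structure_matrix i j ** permutation_matrix \<pi>
       = permutation_matrix \<pi> ** structure_matrix a b"
proof -
  have inj: "inj \<pi>" and surj: "surj \<pi>"
    using \<open>\<pi> permutes UNIV\<close> by (simp_all add: permutes_inj permutes_surj)
  have "(structure_matrix i j ** permutation_matrix \<pi>) $ k $ l
      = (permutation_matrix \<pi> ** structure_matrix a b) $ k $ l" for k l
  proof -
    obtain m where l: "l = \<pi> m"
      using surj by (rule surjE)
    have "m \<in> {i k, j k} \<longleftrightarrow> \<pi> m \<in> \<pi> ` {i k, j k}"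
      by (rule inj_image_mem_iff[OF inj, symmetric])
    also have "\<pi> ` {i k, j k} = {a (\<pi> k), b (\<pi> k)}"
      using assms(11) by simp
    finally show ?thesis
      unfolding l mult_permutation_matrix_entry[OF inj] permutation_matrix_mult_entry
        structure_matrix_entry
      by simp
  qed
  then show ?thesis
    by (simp add: vec_eq_iff)
qed

end
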